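(* Let $M_n$ denote the space of complex $n\times n$ matrices, included in the space $M_{n+1}$ of complex $(n+1)\times(n+1)$ matrices as the upper-left $n\times n$ block (all other entries zero). Let $\tau\in M_{n+1}$ be such that no eigenvalue of $\tau$ is also an eigenvalue of the upper-left $n\times n$ submatrix $\tau_H$ of $\tau$. Let $x\in M_{n+1}$ with $[x,\tau]=0$, where $[a,b]=ab-ba$. Let $z=\mathrm{diag}(1,\dots,1,0)\in M_{n+1}$ (with $n$ ones). Suppose that $[x,[z,\tau]]=[y,\tau]$ for some $y\in M_n$. Then $x$ is a scalar matrix. *)

theory Defs
  imports Complex_Main "Jordan_Normal_Form.Char_Poly"
begin

definition commutator :: "'a :: ring mat \<Rightarrow> 'a mat \<Rightarrow> 'a mat" where
  "commutator a b = a * b - b * a"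

definition upper_left_block :: "nat \<Rightarrow> 'a mat \<Rightarrow> 'a mat" where
  "upper_left_block n A = mat n n (\<lambda>(i, j). A $$ (i, j))"

definition embed_upper_left :: "'a :: zero mat \<Rightarrow> 'a mat" where
  "embed_upper_left y =
    four_block_mat y (0\<^sub>m (dim_row y) 1) (0\<^sub>m 1 (dim_col y)) (0\<^sub>m 1 1)"

definition scalar_matrix :: "'a :: semiring_1 mat \<Rightarrow> bool" where
  "scalar_matrix A \<longleftrightarrow> (\<exists>c. A = c \<cdot>\<^sub>m 1\<^sub>m (dim_row A))"

end

theory Submission
  imports Defs "Jordan_Normal_Form.Schur_Decomposition"
begin

text \<open>
  Subtract a scalar from \<open>x\<close> so that its last diagonal entry
  vanishes. By the Jacobi identity the hypothesis says that \<open>w = y - [x, z]\<close> commutes with \<open>\<tau>\<close>. Since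
  the last row and column of \<open>y\<close> vanish, \<open>w\<close> has the same last column as \<open>x\<close> and the same last row as
  \<open>-x\<close>. An element \<open>u\<close> of the centralizer of \<open>\<tau>\<close> with vanishing last column (or row) intertwines \<open>\<tau>\<close> with
  its upper left block, hence is zero by Sylvester's theorem because the two share no eigenvalue. Thus
  \<open>w = x\<close> and \<open>w = -x\<close>, so \<open>x = 0\<close>.
\<close>

section \<open>Sylvester's theorem on intertwining matrices\<close>

lemma eigenvalue_diag_upper_triangular:
  fixes T :: "'a :: field mat"
  assumes T: "T \<in> carrier_mat n n" and ut: "upper_triangular T" and j: "j < n"
  shows "eigenvalue T (T $$ (j, j))"
proof -
  have "T $$ (j, j) \<in> set (diag_mat T)"
    using T j by (auto simp: diag_mat_def)
  then show ?thesis
    unfolding eigenvalue_root_char_poly[OF T] char_poly_upper_triangular[OF T ut]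
    by (auto simp: poly_prod_list prod_list_zero_iff)
qed

lemma similar_mat_eigenvalue:
  fixes A B :: "'a :: field mat"
  assumes "A \<in> carrier_mat n n" "B \<in> carrier_mat n n" "similar_mat A B"
  shows "eigenvalue A k \<longleftrightarrow> eigenvalue B k"
  using assms by (simp add: eigenvalue_root_char_poly char_poly_similar)

text \<open>The columns of \<open>X\<close> vanish one after another: once those before
  \<open>j\<close> are zero, column \<open>j\<close> of \<open>A * X = X * T\<close> says that
  \<open>A\<close> maps \<open>col X j\<close> to its multiple by \<open>T $$ (j, j)\<close>. That
  scalar is an eigenvalue of \<open>T\<close>, hence not of \<open>A\<close>, so
  \<open>col X j\<close> cannot be an eigenvector.\<close>

lemma intertwining_upper_triangular_eq_0:
  fixes A T :: "'a :: field mat"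
  assumes A: "A \<in> carrier_mat n n" and T: "T \<in> carrier_mat m m" and X: "X \<in> carrier_mat n m"
    and ut: "upper_triangular T"
    and AX: "A * X = X * T"
    and no: "\<not> (\<exists>\<mu>. eigenvalue A \<mu> \<and> eigenvalue T \<mu>)"
  shows "X = 0\<^sub>m n m"
proof -
  have col0: "col X j = 0\<^sub>v n" if "j < m" for j
    using that
  proof (induction j rule: less_induct)
    case (less j)
    have prev: "X $$ (i, k) = 0" if "i < n" "k < j" for i k
    proof -
      have "col X k $ i = 0" using less that by simp
      then show ?thesis using X that less.prems by simp
    qed
    have "A *\<^sub>v col X j = T $$ (j, j) \<cdot>\<^sub>v col X j"
    proof (rule eq_vecI)
      fix i assume "i < dim_vec (T $$ (j, j) \<cdot>\<^sub>v col X j)"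
      then have i: "i < n" using X by simp
      have "(A *\<^sub>v col X j) $ i = (A * X) $$ (i, j)"
        using A X i less.prems by simp
      also have "\<dots> = (\<Sum>k = 0..<m. X $$ (i, k) * T $$ (k, j))"
        unfolding AX using X T i less.prems by (simp add: scalar_prod_def)
      \<comment> \<open>Terms with \<open>k < j\<close> vanish by the induction hypothesis, those
        with \<open>k > j\<close> by triangularity of \<open>T\<close>.\<close>
      also have "\<dots> = (\<Sum>k = 0..<m. if k = j then X $$ (i, j) * T $$ (j, j) else 0)"
      proof (rule sum.cong[OF refl])
        fix k assume "k \<in> {0..<m}"
        then show "X $$ (i, k) * T $$ (k, j) = (if k = j then X $$ (i, j) * T $$ (j, j) else 0)"
          using prev[OF i, of k] upper_triangularD[OF ut, of j k] T by (cases k j rule: linorder_cases) auto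
      qed
      also have "\<dots> = (T $$ (j, j) \<cdot>\<^sub>v col X j) $ i"
        using X i less.prems by simp
      finally show "(A *\<^sub>v col X j) $ i = (T $$ (j, j) \<cdot>\<^sub>v col X j) $ i" .
    qed (use A X in simp)
    moreover have "\<not> eigenvalue A (T $$ (j, j))"
      using no eigenvalue_diag_upper_triangular[OF T ut less.prems] by blast
    ultimately show ?case
      using A col_carrier_vec[OF less.prems X] by (auto simp: eigenvalue_def eigenvector_def)
  qed
  show ?thesis
  proof (rule eq_matI)
    fix i j assume "i < dim_row (0\<^sub>m n m :: 'a mat)" "j < dim_col (0\<^sub>m n m :: 'a mat)"
    then have ij: "i < n" "j < m" by auto
    have "col X j $ i = 0" using col0 ij by simp
    then show "X $$ (i, j) = 0\<^sub>m n m $$ (i, j)" using X ij by simp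
  qed (use X in auto)
qed

text \<open>Schur triangularization \<open>B = P * T * Q\<close> reduces this to the triangular
  case: \<open>X * P\<close> intertwines \<open>A\<close> with \<open>T\<close>, which has the
  eigenvalues of \<open>B\<close>, and \<open>P\<close> is invertible.\<close>

theorem sylvester_intertwining_eq_0:
  fixes A B :: "complex mat"
  assumes A: "A \<in> carrier_mat n n" and B: "B \<in> carrier_mat m m" and X: "X \<in> carrier_mat n m"
    and AX: "A * X = X * B"
    and no: "\<not> (\<exists>\<mu>. eigenvalue A \<mu> \<and> eigenvalue B \<mu>)"
  shows "X = 0\<^sub>m n m"
proof -
  \<comment> \<open>Over the complex numbers the characteristic polynomial splits, as Schur
    decomposition requires.\<close>
  obtain es where "char_poly B = (\<Prod>a\<leftarrow>es. [:- a, 1:])"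
    using char_poly_factorized[OF B] by blast
  then obtain T where ut: "upper_triangular T" and sim: "similar_mat B T"
    using schur_decomposition_exists[OF B] by blast
  then obtain P Q where wit: "similar_mat_wit B T P Q"
    by (auto simp: similar_mat_def)
  note PQ = similar_mat_witD2[OF B wit]
  have T: "T \<in> carrier_mat m m" and P: "P \<in> carrier_mat m m" and Q: "Q \<in> carrier_mat m m"
    by (rule PQ)+
  have "B * P = P * T * (Q * P)"
    using PQ(3) P Q T by (simp add: assoc_mult_mat[of _ m m _ m _ m])
  then have BP: "B * P = P * T"
    using PQ(2) P T by simp
  have "A * (X * P) = A * X * P"
    using A X P by simp
  also have "\<dots> = X * (B * P)"
    unfolding AX using B X P by simp
  also have "\<dots> = X * P * T"
    unfolding BP using X P T by simp
  finally have "A * (X * P) = X * P * T" .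
  moreover have "\<not> (\<exists>\<mu>. eigenvalue A \<mu> \<and> eigenvalue T \<mu>)"
    using no similar_mat_eigenvalue[OF B T sim] by blast
  ultimately have XP: "X * P = 0\<^sub>m n m"
    using intertwining_upper_triangular_eq_0[OF A T _ ut] X P by simp
  have "X = X * (P * Q)"
    using PQ(1) X by simp
  also have "\<dots> = X * P * Q"
    using X P Q by simp
  finally show ?thesis
    using XP Q by simp
qed

section \<open>Centralizer elements with a vanishing last row or column\<close>

text \<open>In the first \<open>n\<close> rows of \<open>\<tau> * u\<close>, the last column of
  \<open>\<tau>\<close> only meets the zero row of \<open>u\<close>. So the first \<open>n\<close>
  rows of \<open>u\<close> intertwine the block of \<open>\<tau>\<close> with \<open>\<tau>\<close>,
  and Sylvester's theorem applies.\<close>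

lemma centralizer_last_row_0_imp_0:
  fixes \<tau> u :: "complex mat"
  assumes \<tau>: "\<tau> \<in> carrier_mat (n + 1) (n + 1)" and u: "u \<in> carrier_mat (n + 1) (n + 1)"
    and no: "\<not> (\<exists>\<mu>. eigenvalue \<tau> \<mu> \<and> eigenvalue (upper_left_block n \<tau>) \<mu>)"
    and comm: "u * \<tau> = \<tau> * u"
    and row: "\<And>j. j < n + 1 \<Longrightarrow> u $$ (n, j) = 0"
  shows "u = 0\<^sub>m (n + 1) (n + 1)"
proof -
  define X where "X = mat n (n + 1) (\<lambda>(i, j). u $$ (i, j))"
  have "upper_left_block n \<tau> * X = X * \<tau>"
  proof (rule eq_matI)
    fix i j assume "i < dim_row (X * \<tau>)" "j < dim_col (X * \<tau>)"
    then have ij: "i < n" "j < n + 1" using \<tau> by (auto simp: X_def)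
    have "(upper_left_block n \<tau> * X) $$ (i, j) = (\<tau> * u) $$ (i, j)"
      using \<tau> u ij row by (simp add: upper_left_block_def X_def scalar_prod_def)
    also have "\<dots> = (X * \<tau>) $$ (i, j)"
      unfolding comm[symmetric] using \<tau> u ij by (simp add: X_def scalar_prod_def)
    finally show "(upper_left_block n \<tau> * X) $$ (i, j) = (X * \<tau>) $$ (i, j)" .
  qed (use \<tau> in \<open>auto simp: upper_left_block_def X_def\<close>)
  then have X0: "X = 0\<^sub>m n (n + 1)"
    using no \<tau> by (intro sylvester_intertwining_eq_0[of "upper_left_block n \<tau>" n \<tau> "n + 1"])
      (auto simp: upper_left_block_def X_def)
  show ?thesis
  proof (rule eq_matI)
    fix i j assume "i < dim_row (0\<^sub>m (n + 1) (n + 1) :: complex mat)"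
      "j < dim_col (0\<^sub>m (n + 1) (n + 1) :: complex mat)"
    then have ij: "i < n + 1" "j < n + 1" by auto
    have "u $$ (i, j) = 0"
    proof (cases "i < n")
      case True
      then have "X $$ (i, j) = u $$ (i, j)" using ij by (simp add: X_def)
      then show ?thesis using X0 True ij by simp
    next
      case False
      then show ?thesis using row[of j] ij by (simp add: less_Suc_eq)
    qed
    then show "u $$ (i, j) = 0\<^sub>m (n + 1) (n + 1) $$ (i, j)" using ij by simp
  qed (use u in auto)
qed

text \<open>Mirror image of the row version: now the last row of \<open>\<tau>\<close> only meets
  the zero column of \<open>u\<close> in \<open>u * \<tau>\<close>, so the intertwiner is formed by
  the first \<open>n\<close> columns.\<close>

lemma centralizer_last_col_0_imp_0:
  fixes \<tau> u :: "complex mat"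
  assumes \<tau>: "\<tau> \<in> carrier_mat (n + 1) (n + 1)" and u: "u \<in> carrier_mat (n + 1) (n + 1)"
    and no: "\<not> (\<exists>\<mu>. eigenvalue \<tau> \<mu> \<and> eigenvalue (upper_left_block n \<tau>) \<mu>)"
    and comm: "u * \<tau> = \<tau> * u"
    and col: "\<And>i. i < n + 1 \<Longrightarrow> u $$ (i, n) = 0"
  shows "u = 0\<^sub>m (n + 1) (n + 1)"
proof -
  define X where "X = mat (n + 1) n (\<lambda>(i, j). u $$ (i, j))"
  have "\<tau> * X = X * upper_left_block n \<tau>"
  proof (rule eq_matI)
    fix i j assume "i < dim_row (X * upper_left_block n \<tau>)" "j < dim_col (X * upper_left_block n \<tau>)"
    then have ij: "i < n + 1" "j < n" by (auto simp: X_def upper_left_block_def)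
    have "(\<tau> * X) $$ (i, j) = (\<tau> * u) $$ (i, j)"
      using \<tau> u ij by (simp add: X_def scalar_prod_def)
    also have "\<dots> = (X * upper_left_block n \<tau>) $$ (i, j)"
      unfolding comm[symmetric] using \<tau> u ij col
      by (simp add: upper_left_block_def X_def scalar_prod_def)
    finally show "(\<tau> * X) $$ (i, j) = (X * upper_left_block n \<tau>) $$ (i, j)" .
  qed (use \<tau> in \<open>auto simp: upper_left_block_def X_def\<close>)
  then have X0: "X = 0\<^sub>m (n + 1) n"
    using no \<tau> by (intro sylvester_intertwining_eq_0[of \<tau> "n + 1" "upper_left_block n \<tau>" n])
      (auto simp: upper_left_block_def X_def)
  show ?thesis
  proof (rule eq_matI)
    fix i j assume "i < dim_row (0\<^sub>m (n + 1) (n + 1) :: complex mat)"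
      "j < dim_col (0\<^sub>m (n + 1) (n + 1) :: complex mat)"
    then have ij: "i < n + 1" "j < n + 1" by auto
    have "u $$ (i, j) = 0"
    proof (cases "j < n")
      case True
      then have "X $$ (i, j) = u $$ (i, j)" using ij by (simp add: X_def)
      then show ?thesis using X0 True ij by simp
    next
      case False
      then show ?thesis using col[of i] ij by (simp add: less_Suc_eq)
    qed
    then show "u $$ (i, j) = 0\<^sub>m (n + 1) (n + 1) $$ (i, j)" using ij by simp
  qed (use u in auto)
qed

section \<open>Commutator identities\<close>

lemma diff_diff_swap_mat:
  fixes a b c d :: "'a :: ab_group_add mat"
  assumes "a \<in> carrier_mat m n" "b \<in> carrier_mat m n" "c \<in> carrier_mat m n" "d \<in> carrier_mat m n"
  shows "(a - b) - (c - d) = (a - c) - (b - d)"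
  using assms by (intro eq_matI) auto

text \<open>This is the Jacobi identity \<open>[x,[z,t]] = [[x,z],t] + [z,[x,t]]\<close>, whose last
  term is zero because \<open>x\<close> commutes with \<open>t\<close>.\<close>

lemma commutator_jacobi_commuting:
  fixes x z t :: "'a :: comm_ring_1 mat"
  assumes x: "x \<in> carrier_mat n n" and z: "z \<in> carrier_mat n n" and t: "t \<in> carrier_mat n n"
    and comm: "x * t = t * x"
  shows "commutator x (commutator z t) = commutator (commutator x z) t"
proof -
  have 1: "x * (t * z) = t * (x * z)"
    using assoc_mult_mat[OF x t z] assoc_mult_mat[OF t x z] comm by metis
  have 2: "z * t * x = z * x * t"
    using assoc_mult_mat[OF z t x] assoc_mult_mat[OF z x t] comm by metis
  have "commutator x (commutator z t) = (x * (z * t) - x * (t * z)) - (z * t * x - t * z * x)"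
    using x z t by (simp add: commutator_def mult_minus_distrib_mat[of _ n n _ n]
        minus_mult_distrib_mat[of _ n n _ _ n])
  also have "\<dots> = (x * z * t - t * (x * z)) - (z * x * t - t * (z * x))"
    unfolding 1 2 using assoc_mult_mat[OF x z t] assoc_mult_mat[OF t z x] by simp
  also have "\<dots> = (x * z * t - z * x * t) - (t * (x * z) - t * (z * x))"
    using x z t by (intro diff_diff_swap_mat[of _ n n]) auto
  also have "\<dots> = commutator (commutator x z) t"
    using x z t by (simp add: commutator_def mult_minus_distrib_mat[of _ n n _ n]
        minus_mult_distrib_mat[of _ n n _ _ n])
  finally show ?thesis .
qed

lemma commutator_eq_0_iff:
  fixes a b :: "'a :: ring mat"
  assumes "a \<in> carrier_mat n n" "b \<in> carrier_mat n n"
  shows "commutator a b = 0\<^sub>m n n \<longleftrightarrow> a * b = b * a"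
proof
  assume c: "commutator a b = 0\<^sub>m n n"
  show "a * b = b * a"
  proof (rule eq_matI)
    fix i j assume ij: "i < dim_row (b * a)" "j < dim_col (b * a)"
    have "commutator a b $$ (i, j) = 0" using c ij assms by simp
    then show "(a * b) $$ (i, j) = (b * a) $$ (i, j)"
      using ij assms by (simp add: commutator_def)
  qed (use assms in auto)
qed (use assms in \<open>auto simp: commutator_def\<close>)

section \<open>Comparison of \<open>w\<close> with the normalized \<open>x\<close>\<close>

theorem theorem2:
  fixes n :: nat and \<tau> x z y :: "complex mat"
  assumes "\<tau> \<in> carrier_mat (n + 1) (n + 1)"
    and "\<not> (\<exists>\<mu>. eigenvalue \<tau> \<mu> \<and> eigenvalue (upper_left_block n \<tau>) \<mu>)"
    and "x \<in> carrier_mat (n + 1) (n + 1)"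
    and "commutator x \<tau> = 0\<^sub>m (n + 1) (n + 1)"
    and "z = mat_diag (n + 1) (\<lambda>i. if i < n then 1 else 0)"
    and "y \<in> carrier_mat n n"
    and "commutator x (commutator z \<tau>) = commutator (embed_upper_left y) \<tau>"
  shows "scalar_matrix x"
proof -
  note \<tau> = assms(1) and no = assms(2) and x = assms(3)
  define N where "N = n + 1"
  define Y where "Y = embed_upper_left y"
  define c where "c = x $$ (n, n)"
  \<comment> \<open>Subtracting a scalar matrix keeps \<open>x'\<close> in the centralizer of
    \<open>\<tau>\<close>. The corner entry of \<open>w\<close> is zero, so that of
    \<open>x'\<close> must be zero too for the comparisons below.\<close>
  define x' where "x' = x - c \<cdot>\<^sub>m 1\<^sub>m N"
  define k where "k = commutator x z"
  define w where "w = Y - k"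
  have \<tau>N: "\<tau> \<in> carrier_mat N N" and xN: "x \<in> carrier_mat N N" and nN: "n < N"
    using \<tau> x by (auto simp: N_def)
  have z: "z \<in> carrier_mat N N"
    using assms(5) by (simp add: N_def mat_diag_def)
  have Y: "Y \<in> carrier_mat N N"
    using four_block_carrier_mat[OF assms(6), of "0\<^sub>m 1 1" 1 1] assms(6)
    by (simp add: Y_def embed_upper_left_def N_def)
  have k: "k \<in> carrier_mat N N"
    using xN z unfolding k_def commutator_def by (intro minus_carrier_mat mult_carrier_mat[of _ N N])
  have x': "x' \<in> carrier_mat N N" and w: "w \<in> carrier_mat N N"
    using xN Y k by (auto simp: x'_def w_def)
  have x\<tau>: "x * \<tau> = \<tau> * x"
    using assms(4) commutator_eq_0_iff[OF xN \<tau>N] by (simp add: N_def)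
  have x'\<tau>: "x' * \<tau> = \<tau> * x'"
    using xN \<tau>N x\<tau> by (simp add: x'_def mult_minus_distrib_mat[of _ N N _ N]
        minus_mult_distrib_mat[of _ N N _ _ N] mult_smult_distrib[of _ N N _ N]
        mult_smult_assoc_mat[of _ N N _ N])
  have "commutator k \<tau> = commutator Y \<tau>"
    using assms(7) commutator_jacobi_commuting[OF xN z \<tau>N x\<tau>] by (simp add: k_def Y_def)
  then have eq: "Y * \<tau> - \<tau> * Y = k * \<tau> - \<tau> * k"
    by (simp add: commutator_def)
  have "commutator w \<tau> = (Y * \<tau> - k * \<tau>) - (\<tau> * Y - \<tau> * k)"
    using \<tau>N k Y by (simp add: w_def commutator_def mult_minus_distrib_mat[of _ N N _ N]
        minus_mult_distrib_mat[of _ N N _ _ N])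
  also have "\<dots> = (Y * \<tau> - \<tau> * Y) - (k * \<tau> - \<tau> * k)"
    using \<tau>N k Y by (intro diff_diff_swap_mat[of _ N N]) auto
  also have "\<dots> = 0\<^sub>m N N"
    unfolding eq using \<tau>N k by (intro minus_r_inv_mat minus_carrier_mat mult_carrier_mat[of _ N N])
  finally have w\<tau>: "w * \<tau> = \<tau> * w"
    using commutator_eq_0_iff[OF w \<tau>N] by simp
  \<comment> \<open>Commuting with the projection \<open>z\<close> leaves only the off-diagonal
    blocks of \<open>x\<close>: the last column above the corner with sign -1, the last row left of
    the corner with sign +1. The opposite signs lead to the two relations \<open>w = x'\<close> and
    \<open>w = -x'\<close>.\<close>
  have k_entry: "k $$ (i, j) = x $$ (i, j) * ((if j < n then 1 else 0) - (if i < n then 1 else 0))"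
    if "i < N" "j < N" for i j
  proof -
    have "x * z = mat N N (\<lambda>(i, j). x $$ (i, j) * (if j < n then 1 else 0))"
      unfolding assms(5) N_def[symmetric] by (rule mat_diag_mult_right[OF xN])
    moreover have "z * x = mat N N (\<lambda>(i, j). (if i < n then 1 else 0) * x $$ (i, j))"
      unfolding assms(5) N_def[symmetric] by (rule mat_diag_mult_left[OF xN])
    ultimately show ?thesis
      using that by (simp add: k_def commutator_def)
  qed
  have Y0: "Y $$ (i, n) = 0" "Y $$ (n, i) = 0" if "i < N" for i
    using that assms(6) by (auto simp: Y_def embed_upper_left_def N_def less_Suc_eq)
  have "(w - x') $$ (i, n) = 0" if "i < N" for i
    using that nN Y k xN x' by (auto simp: w_def x'_def Y0 k_entry c_def N_def less_Suc_eq)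
  moreover have "(w - x') * \<tau> = \<tau> * (w - x')"
    using w\<tau> x'\<tau> w x' \<tau>N by (simp add: mult_minus_distrib_mat[of _ N N _ N]
        minus_mult_distrib_mat[of _ N N _ _ N])
  ultimately have minus: "w - x' = 0\<^sub>m N N"
    unfolding N_def by (intro centralizer_last_col_0_imp_0[OF \<tau> _ no] minus_carrier_mat[OF x'[unfolded N_def]])
  have "(w + x') $$ (n, j) = 0" if "j < N" for j
    using that nN Y k xN x' by (auto simp: w_def x'_def Y0 k_entry c_def N_def less_Suc_eq)
  moreover have "(w + x') * \<tau> = \<tau> * (w + x')"
    using w\<tau> x'\<tau> w x' \<tau>N by (simp add: mult_add_distrib_mat[of _ N N _ N]
        add_mult_distrib_mat[of _ N N _ _ N])
  ultimately have plus: "w + x' = 0\<^sub>m N N"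
    unfolding N_def by (intro centralizer_last_row_0_imp_0[OF \<tau> _ no] add_carrier_mat[OF x'[unfolded N_def]])
  have "x = c \<cdot>\<^sub>m 1\<^sub>m N"
  proof (rule eq_matI)
    fix i j assume "i < dim_row (c \<cdot>\<^sub>m 1\<^sub>m N)" "j < dim_col (c \<cdot>\<^sub>m 1\<^sub>m N)"
    then have ij: "i < N" "j < N" by auto
    have "(w - x') $$ (i, j) = 0" "(w + x') $$ (i, j) = 0"
      using minus plus ij by auto
    then have "w $$ (i, j) = x' $$ (i, j)" "w $$ (i, j) + x' $$ (i, j) = 0"
      using ij w x' by auto
    \<comment> \<open>The two relations give twice the entry equal to zero, and 2 is invertible in
      the complex numbers.\<close>
    then have "x' $$ (i, j) = 0" by simp
    then show "x $$ (i, j) = (c \<cdot>\<^sub>m 1\<^sub>m N) $$ (i, j)"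
      using ij xN by (simp add: x'_def)
  qed (use xN in auto)
  then show ?thesis
    using xN unfolding scalar_matrix_def by (metis carrier_matD(1))
qed

end
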